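(* If $G$ is a connected biconvex bipartite graph of order $n$ (i.e., with $n$ vertices), then $b(G) \le \lceil \sqrt{n} \rceil$, where $b(G)$ denotes the burning number of $G$.
   Context: All graphs are finite, simple and undirected. A graph $G=(V,E)$ is bipartite, written $G=(A,B,E)$, if $V$ is partitioned into two sets $A$ and $B$ such that every edge has one end-point in $A$ and the other in $B$. A bipartite graph $G=(A,B,E)$ is a biconvex bipartite graph if there exist (linear) orderings $<_A$ of $A$ and $<_B$ of $B$ such that the neighbors of every vertex in $A$ are consecutive with respect to $<_B$ and the neighbors of every vertex in $B$ are consecutive with respect to $<_A$ (a set of vertices is consecutive with respect to a linear ordering if, whenever $x$ and $y$ are in the set, every $w$ lying between $x$ and $y$ in the ordering is also in the set). The burning number $b(G)$ of a graph $G$ is the minimum number of iterations required to burn all vertices of $G$ (initially all unburned), where in each iteration the fire spreads from all vertices burned in earlier iterations to their neighbors and, in addition, one chosen vertex can be burned; burned vertices remain burned. Equivalently, $b(G)$ is the least $k$ for which there is a sequence of vertices $(v_1,\dots,v_k)$ such that every vertex of $G$ is at distance at most $k-i$ from $v_i$ for some $i\in\{1,\dots,k\}$. *)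

theory Defs
  imports Complex_Main "Graph_Theory.Graph_Theory"
begin

text \<open>
  Finite simple undirected graphs are the locale \<^locale>\<open>graph\<close>: finite digraphs without loops and
  multiple arcs whose adjacency relation \<^term>\<open>arcs_ends G\<close> is symmetric, so that an undirected
  edge is a pair of opposite arcs.
\<close>

definition neighbours :: "('a,'b) pre_digraph \<Rightarrow> 'a \<Rightarrow> 'a set" where
  "neighbours G u = {v. u \<rightarrow>\<^bsub>G\<^esub> v}"

text \<open>One of the two sides may be empty; in the single-vertex graph it has to be.\<close>

definition bipartition :: "('a,'b) pre_digraph \<Rightarrow> 'a set \<Rightarrow> 'a set \<Rightarrow> bool" where
  "bipartition G A B \<longleftrightarrow> A \<union> B = verts G \<and> A \<inter> B = {} \<and>
     (\<forall>u v. u \<rightarrow>\<^bsub>G\<^esub> v \<longrightarrow> u \<in> A \<and> v \<in> B \<or> u \<in> B \<and> v \<in> A)"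

text \<open>The order \<open>r\<close> is reflexive; for the end-points \<open>w = x\<close> and \<open>w = y\<close> the condition is void.\<close>

definition consecutive :: "'a rel \<Rightarrow> 'a set \<Rightarrow> bool" where
  "consecutive r S \<longleftrightarrow> (\<forall>x\<in>S. \<forall>y\<in>S. \<forall>w. (x, w) \<in> r \<and> (w, y) \<in> r \<longrightarrow> w \<in> S)"

definition biconvex_bipartite :: "('a,'b) pre_digraph \<Rightarrow> bool" where
  "biconvex_bipartite G \<longleftrightarrow> (\<exists>A B. bipartition G A B \<and>
     (\<exists>rA rB. linear_order_on A rA \<and> linear_order_on B rB \<and>
        (\<forall>a\<in>A. consecutive rB (neighbours G a)) \<and>
        (\<forall>b\<in>B. consecutive rA (neighbours G b))))"

text \<open>
  \<open>burned G s t\<close> is the set of vertices burned after \<open>t\<close> iterations. In iteration \<open>t + 1\<close> the fire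
  spreads from the vertices burned in earlier iterations, and \<open>s t\<close> is the vertex chosen in that
  iteration, or \<open>None\<close> if no vertex is chosen.
\<close>

primrec burned :: "('a,'b) pre_digraph \<Rightarrow> (nat \<Rightarrow> 'a option) \<Rightarrow> nat \<Rightarrow> 'a set" where
  "burned G s 0 = {}"
| "burned G s (Suc t) =
     burned G s t \<union> (\<Union>u \<in> burned G s t. neighbours G u) \<union> set_option (s t)"

definition burnable_in :: "('a,'b) pre_digraph \<Rightarrow> nat \<Rightarrow> bool" where
  "burnable_in G k \<longleftrightarrow>
     (\<exists>s. (\<forall>t. set_option (s t) \<subseteq> verts G) \<and> burned G s k = verts G)"

definition burning_number :: "('a,'b) pre_digraph \<Rightarrow> nat" where
  "burning_number G = (LEAST k. burnable_in G k)"

text \<open>The minimum exists, since the vertices can be chosen one after the other.\<close>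

lemma (in fin_digraph) burnable_in_card: "burnable_in G (card (verts G))"
proof -
  obtain f where f: "bij_betw f {0..<card (verts G)} (verts G)"
    using ex_bij_betw_nat_finite[OF finite_verts] by blast
  define s where "s t = (if t < card (verts G) then Some (f t) else None)" for t
  have s: "set_option (s t) \<subseteq> verts G" for t
    using f by (auto simp: s_def bij_betw_def)
  have "burned G s k \<subseteq> verts G" for k
    using s by (induction k) (auto simp: neighbours_def dest: adj_in_verts)
  moreover have "f ` {0..<k} \<subseteq> burned G s k" if "k \<le> card (verts G)" for k
    using that by (induction k) (auto simp: s_def atLeast0_lessThan_Suc)
  ultimately have "burned G s (card (verts G)) = verts G"
    using f by (fastforce simp: bij_betw_def)
  with s show ?thesis
    unfolding burnable_in_def by blast
qed

end

theory Submission
  imports Defs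
begin

text \<open>
  View the edges as cells of a grid whose rows are \<open>A\<close> and whose columns are \<open>B\<close>. Biconvexity makes
  this set of cells convex in both directions, and connectedness then puts certain corner cells into
  it, so that any path through suitable extremal rows and columns dominates the graph. Hence the graph
  contains a spanning caterpillar.

  A caterpillar with at most \<open>k\<^sup>2\<close> vertices is covered by balls of radii \<open>0, \<dots>, k - 1\<close>: start the spine
  at a leaf and cut off at least \<open>2 * k - 1\<close> vertices from this end with a ball of radius \<open>k - 1\<close>.
  This fails only if the spine begins with \<open>2 * k - 2\<close> vertices without leaves, followed by a vertex
  that has one. In that case first cut off \<open>2 * k - 3\<close> vertices with the ball of radius \<open>k - 2\<close>;
  the ball of radius \<open>k - 1\<close> then reaches that leaf and cuts off \<open>2 * k - 1\<close> more, and
  \<open>(2 * k - 3) + (2 * k - 1) = k\<^sup>2 - (k - 2)\<^sup>2\<close>.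
\<close>

section \<open>Covering caterpillars by balls\<close>

primrec nball :: "('a \<Rightarrow> 'a set) \<Rightarrow> nat \<Rightarrow> 'a \<Rightarrow> 'a set" where
  "nball N 0 v = {v}"
| "nball N (Suc r) v = nball N r v \<union> (\<Union>u \<in> nball N r v. N u)"

lemma nball_mono: "r \<le> s \<Longrightarrow> nball N r v \<subseteq> nball N s v"
  by (induction s) (auto simp: le_Suc_eq)

text \<open>Centres are indexed by radius, so each radius serves one ball. \<open>R\<close> is an
  arbitrary set because the induction must also handle radius sets with a gap. Centres range over
  \<open>V\<close>, so radii left over still have a place when \<open>W\<close> is empty.\<close>

definition ball_cover :: "('a \<Rightarrow> 'a set) \<Rightarrow> 'a set \<Rightarrow> nat set \<Rightarrow> 'a set \<Rightarrow> bool" where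
  "ball_cover N V R W \<longleftrightarrow> (\<exists>c. (\<forall>r\<in>R. c r \<in> V) \<and> W \<subseteq> (\<Union>r\<in>R. nball N r (c r)))"

lemma ball_cover_empty: "V \<noteq> {} \<Longrightarrow> ball_cover N V R {}"
  unfolding ball_cover_def by auto

lemma ball_cover_insert:
  assumes "ball_cover N V R W'" "W \<subseteq> W' \<union> nball N r v" "v \<in> V" "r \<notin> R"
  shows "ball_cover N V (insert r R) W"
proof -
  obtain c where c: "\<forall>r\<in>R. c r \<in> V" "W' \<subseteq> (\<Union>r\<in>R. nball N r (c r))"
    using assms(1) unfolding ball_cover_def by blast
  have "\<forall>s\<in>insert r R. (c(r := v)) s \<in> V"
    using c(1) assms(3,4) by auto
  moreover have "W \<subseteq> (\<Union>s\<in>insert r R. nball N s ((c(r := v)) s))"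
    using c(2) assms(2,4) by fastforce
  ultimately show ?thesis
    unfolding ball_cover_def by blast
qed

lemma set_drop_distinct:
  assumes "distinct p"
  shows "set (drop n p) = set p - set (take n p)"
proof -
  have "set p = set (take n p) \<union> set (drop n p)" by (metis append_take_drop_id set_append)
  moreover have "set (take n p) \<inter> set (drop n p) = {}"
    using assms by (simp add: set_take_disj_set_drop_if_distinct)
  ultimately show ?thesis by blast
qed

lemma card_Diff_take:
  assumes "distinct p" "set p \<subseteq> W" "finite W" "n \<le> length p"
    and "L \<subseteq> W - set p"
  shows "card (W - (set (take n p) \<union> L)) + n + card L = card W"
proof -
  have t: "set (take n p) \<subseteq> set p" by (rule set_take_subset)
  have L: "finite L" using assms(3,5) by (meson finite_Diff finite_subset)
  have "card (set (take n p) \<union> L) = n + card L"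
    using assms t L by (subst card_Un_disjoint) (auto simp: distinct_card)
  moreover have "card (W - (set (take n p) \<union> L)) = card W - card (set (take n p) \<union> L)"
    using assms t L by (intro card_Diff_subset) auto
  moreover have "card (set (take n p) \<union> L) \<le> card W"
    using assms t by (intro card_mono) auto
  ultimately show ?thesis by linarith
qed

section \<open>Walks, balls and spines\<close>

locale symmetric_neighbourhood =
  fixes N :: "'a \<Rightarrow> 'a set"
  assumes sym: "v \<in> N u \<Longrightarrow> u \<in> N v"
begin

abbreviation walk :: "'a list \<Rightarrow> bool" where
  "walk \<equiv> successively (\<lambda>u v. v \<in> N u)"

abbreviation path :: "'a list \<Rightarrow> bool" where
  "path p \<equiv> walk p \<and> distinct p"

lemma walk_nball_forward:
  assumes "walk p"
  shows "i + d < length p \<Longrightarrow> p ! (i + d) \<in> nball N d (p ! i)"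
proof (induction d)
  case (Suc d)
  have "p ! (Suc (i + d)) \<in> N (p ! (i + d))"
    using assms Suc.prems by (auto simp: successively_conv_nth)
  with Suc show ?case by auto
qed auto

lemma walk_nball_backward:
  assumes "walk p"
  shows "i + d < length p \<Longrightarrow> p ! i \<in> nball N d (p ! (i + d))"
proof (induction d arbitrary: i)
  case (Suc d)
  have "p ! (Suc i) \<in> N (p ! i)"
    using assms Suc.prems by (auto simp: successively_conv_nth)
  then have "p ! i \<in> N (p ! Suc i)" by (rule sym)
  with Suc.IH[of "Suc i"] Suc.prems show ?case by auto
qed auto

lemma walk_nball:
  assumes "walk p" "i < length p" "c < length p" "i \<le> c + K" "c \<le> i + K"
  shows "p ! i \<in> nball N K (p ! c)"
proof (cases "i \<le> c")
  case True
  then show ?thesis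
    using walk_nball_backward[OF assms(1), of i "c - i"] nball_mono[of "c - i" K N "p ! c"] assms
    by fastforce
next
  case False
  then show ?thesis
    using walk_nball_forward[OF assms(1), of c "i - c"] nball_mono[of "i - c" K N "p ! c"] assms
    by fastforce
qed

text \<open>One unit of the radius is kept for the last step to \<open>w\<close>; this makes the
  inequalities strict.\<close>

lemma walk_nball_nbr:
  assumes "walk p" "i < length p" "c < length p" "i < c + K" "c < i + K" "w \<in> N (p ! i)"
  shows "w \<in> nball N K (p ! c)"
proof -
  obtain K' where "K = Suc K'"
    using assms(4,5) by (cases K) auto
  then show ?thesis
    using walk_nball[OF assms(1-3), of K'] assms(4-6) by auto
qed

text \<open>The caterpillar is a subgraph on the vertex set \<open>W\<close>; further edges are allowed.\<close>

definition spine :: "'a list \<Rightarrow> 'a set \<Rightarrow> bool" where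
  "spine p W \<longleftrightarrow> path p \<and> set p \<subseteq> W \<and> W \<subseteq> set p \<union> (\<Union>u\<in>set p. N u)"

text \<open>A spine whose head supports nothing: it plays the part of a leaf, so a ball at the front
  wastes no radius on leaves there.\<close>

definition leaf_spine :: "'a list \<Rightarrow> 'a set \<Rightarrow> bool" where
  "leaf_spine p W \<longleftrightarrow> path p \<and> set p \<subseteq> W \<and> W \<subseteq> set p \<union> (\<Union>u\<in>set (tl p). N u)"

text \<open>A vertex not dominated by the tail hangs at the head and can be put in front. The old
  head then belongs to the tail, so one extension suffices.\<close>

lemma ex_leaf_spine:
  assumes "spine p W"
  obtains q where "leaf_spine q W"
proof (cases "W \<subseteq> set p \<union> (\<Union>u\<in>set (tl p). N u)")
  case True
  with assms that show ?thesis
    unfolding spine_def leaf_spine_def by blast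
next
  case False
  then obtain w where w: "w \<in> W" "w \<notin> set p" "w \<notin> (\<Union>u\<in>set (tl p). N u)" by blast
  with assms have "p \<noteq> []" "w \<in> N (hd p)"
    unfolding spine_def by (cases p; auto)+
  with assms w have "leaf_spine (w # p) W"
    unfolding spine_def leaf_spine_def by (auto simp: successively_Cons intro: sym)
  with that show ?thesis .
qed

lemma walk_drop: "walk p \<Longrightarrow> walk (drop n p)"
  by (metis append_take_drop_id successively_append_iff)

lemma leaf_spine_short:
  assumes "leaf_spine p W" "p \<noteq> []" "length p \<le> 2 * K"
  shows "\<exists>c\<in>W. W \<subseteq> nball N K c"
proof -
  \<comment> \<open>Index \<open>K\<close> reaches the indices up to \<open>2 * K\<close> and the
    leaves at those strictly between; the minimum handles spines that end before index
    \<open>K\<close>.\<close>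
  define c where "c = min K (length p - 1)"
  have c: "c < length p" using assms(2) unfolding c_def by (cases p) auto
  have p: "walk p" "set p \<subseteq> W" "W \<subseteq> set p \<union> (\<Union>u\<in>set (tl p). N u)"
    using assms(1) unfolding leaf_spine_def by auto
  have "w \<in> nball N K (p ! c)" if w: "w \<in> W" for w
  proof -
    consider "w \<in> set p" | u where "u \<in> set (tl p)" "w \<in> N u"
      using w p(3) by blast
    then show ?thesis
    proof cases
      case 1
      then obtain i where i: "i < length p" "w = p ! i" by (auto simp: in_set_conv_nth)
      then show ?thesis
        using walk_nball[OF p(1) i(1) c, of K] assms(3) by (auto simp: c_def)
    next
      case 2
      then obtain i where "i < length (tl p)" "u = tl p ! i" by (auto simp: in_set_conv_nth)
      then have i: "Suc i < length p" "u = p ! Suc i" by (auto simp: nth_tl)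
      then show ?thesis
        using walk_nball_nbr[OF p(1) i(1) c, of K w] assms(3) 2 by (auto simp: c_def)
    qed
  qed
  moreover have "p ! c \<in> W" using c p(2) by auto
  ultimately show ?thesis by blast
qed

text \<open>
  A ball of radius \<open>K\<close> around \<open>p ! K\<close> covers the first \<open>2 * K + 1\<close> vertices of the spine and the
  leaves at all of these except the two outer ones. If it covers some leaf, then \<open>p ! (2 * K)\<close>
  can stay in the remaining caterpillar to support its own leaves.
\<close>

lemma leaf_spine_split:
  assumes "leaf_spine p W" "finite W" "2 * K < length p"
    and "(\<exists>w\<in>W - set p. \<exists>i. 0 < i \<and> i < 2 * K \<and> w \<in> N (p ! i)) \<or>
         W - set p \<subseteq> (\<Union>i\<in>{i. 0 < i \<and> i < length p \<and> i \<noteq> 2 * K}. N (p ! i))"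
  obtains W' q c where "spine q W'" "c \<in> W" "W' \<subseteq> W" "W \<subseteq> W' \<union> nball N K c"
    "card W' + (2 * K + 1) \<le> card W"
proof -
  note result = that
  have p: "walk p" "distinct p" "set p \<subseteq> W" "W \<subseteq> set p \<union> (\<Union>u\<in>set (tl p). N u)"
    using assms(1) unfolding leaf_spine_def by auto
  define L where "L = {w \<in> W - set p. \<exists>i. 0 < i \<and> i < 2 * K \<and> w \<in> N (p ! i)}"
  have idx: "\<exists>i. 0 < i \<and> i < length p \<and> w \<in> N (p ! i)" if w: "w \<in> W - set p" for w
  proof -
    obtain u where "u \<in> set (tl p)" "w \<in> N u" using w p(4) by blast
    then obtain i where "i < length (tl p)" "w \<in> N (tl p ! i)" by (auto simp: in_set_conv_nth)
    then show ?thesis by (intro exI[of _ "Suc i"]) (auto simp: nth_tl)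
  qed
  have ball: "set (take n p) \<union> L \<subseteq> nball N K (p ! K)" if n: "n \<le> 2 * K + 1" for n
  proof
    fix w assume "w \<in> set (take n p) \<union> L"
    then consider "w \<in> set (take n p)" | "w \<in> L" by blast
    then show "w \<in> nball N K (p ! K)"
    proof cases
      case 1
      then obtain i where i: "i < length p" "i < n" "w = p ! i" by (auto simp: in_set_conv_nth)
      then show ?thesis
        using walk_nball[OF p(1) i(1), of K K] assms(3) n by auto
    next
      case 2
      then obtain i where i: "0 < i" "i < 2 * K" "w \<in> N (p ! i)" by (auto simp: L_def)
      then show ?thesis
        using walk_nball_nbr[OF p(1), of i K K w] assms(3) by auto
    qed
  qed
  note drop = set_drop_distinct[OF p(2)]
  have LW: "L \<subseteq> W - set p" by (auto simp: L_def)
  \<comment> \<open>\<open>n\<close> counts the spine vertices cut off: \<open>2 * K\<close> if a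
    covered leaf makes up the difference, and \<open>2 * K + 1\<close> otherwise.\<close>
  have main: thesis
    if n: "n \<le> 2 * K + 1" "2 * K + 1 \<le> n + card L"
      and leaf: "\<And>w. w \<in> W - set p \<Longrightarrow> w \<notin> L \<Longrightarrow> \<exists>i\<ge>n. i < length p \<and> w \<in> N (p ! i)" for n
  proof (rule result)
    show "p ! K \<in> W" using p(3) assms(3) by auto
    show "W - (set (take n p) \<union> L) \<subseteq> W" by blast
    show "W \<subseteq> W - (set (take n p) \<union> L) \<union> nball N K (p ! K)" using ball[OF n(1)] by blast
    show "card (W - (set (take n p) \<union> L)) + (2 * K + 1) \<le> card W"
      using card_Diff_take[OF p(2,3) assms(2) _ LW, of n] assms(3) n by linarith
    have "w \<in> (\<Union>u\<in>set (drop n p). N u)" if w: "w \<in> W - set p" "w \<notin> L" for w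
    proof -
      obtain i where "i \<ge> n" "i < length p" "w \<in> N (p ! i)" using leaf[OF w] by blast
      moreover from this have "p ! i \<in> set (drop n p)"
        by (auto simp: in_set_conv_nth intro!: exI[of _ "i - n"])
      ultimately show ?thesis by blast
    qed
    then have "W - (set (take n p) \<union> L) \<subseteq> set (drop n p) \<union> (\<Union>u\<in>set (drop n p). N u)"
      unfolding drop by blast
    moreover have "set (drop n p) \<subseteq> W - (set (take n p) \<union> L)"
      unfolding drop using p(3) LW by blast
    ultimately show "spine (drop n p) (W - (set (take n p) \<union> L))"
      unfolding spine_def using p(1,2) walk_drop by auto
  qed
  show thesis
  proof (cases "L = {}")
    case False
    have "finite L" using LW assms(2) by (meson finite_Diff finite_subset)
    with False have "card L \<ge> 1" by (simp add: Suc_le_eq card_gt_0_iff)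
    then show ?thesis
    proof (intro main[of "2 * K"])
      fix w assume w: "w \<in> W - set p" "w \<notin> L"
      then obtain i where "0 < i" "i < length p" "w \<in> N (p ! i)" using idx by blast
      moreover from this w have "\<not> i < 2 * K" unfolding L_def by blast
      ultimately show "\<exists>i\<ge>2 * K. i < length p \<and> w \<in> N (p ! i)"
        by (intro exI[of _ i]) auto
    qed auto
  next
    \<comment> \<open>No leaf hangs before index \<open>2 * K\<close>, and by \<open>*\<close> none
      depends on that index, so \<open>p ! (2 * K)\<close> can go as well.\<close>
    case True
    then have *: "W - set p \<subseteq> (\<Union>i\<in>{i. 0 < i \<and> i < length p \<and> i \<noteq> 2 * K}. N (p ! i))"
      using assms(4) unfolding L_def by blast
    show ?thesis
    proof (intro main[of "2 * K + 1"])
      fix w assume w: "w \<in> W - set p" "w \<notin> L"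
      then obtain i where i: "0 < i" "i < length p" "i \<noteq> 2 * K" "w \<in> N (p ! i)" using * by blast
      with w have "\<not> i < 2 * K" unfolding L_def by blast
      with i show "\<exists>i\<ge>2 * K + 1. i < length p \<and> w \<in> N (p ! i)"
        by (intro exI[of _ i]) auto
    qed auto
  qed
qed

text \<open>Strong induction on \<open>k\<close>, since the exceptional case uses up two radii at
  once and falls back to \<open>k - 2\<close>.\<close>

lemma spine_ball_cover:
  assumes "spine p W" "finite W" "card W \<le> k\<^sup>2" "W \<subseteq> V" "V \<noteq> {}"
  shows "ball_cover N V {..<k} W"
  using assms(1-4)
proof (induction k arbitrary: p W rule: less_induct)
  case (less k)
  show ?case
  proof (cases "W = {}")
    case True
    then show ?thesis using ball_cover_empty[OF assms(5)] by simp
  next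
    case ne: False
    with less.prems(2,3) obtain K where k: "k = Suc K" by (cases k) auto
    obtain q where q: "leaf_spine q W" using ex_leaf_spine[OF less.prems(1)] .
    have qne: "q \<noteq> []" using ne q unfolding leaf_spine_def by auto
    have short_cover: "ball_cover N V R W'"
      if q': "leaf_spine q' W'" "q' \<noteq> []" "length q' \<le> 2 * J" "W' \<subseteq> V" "J \<in> R" for q' W' J R
    proof -
      obtain c where c: "c \<in> W'" "W' \<subseteq> nball N J c"
        using leaf_spine_short[OF q'(1-3)] by blast
      have "ball_cover N V (insert J (R - {J})) W'"
        by (rule ball_cover_insert[OF ball_cover_empty[OF assms(5)], of W' N J c]) (use c q' in auto)
      then show ?thesis using q'(5) by (simp add: insert_absorb)
    qed
    let ?leafy = "\<exists>w\<in>W - set q. \<exists>i. 0 < i \<and> i < 2 * K \<and> w \<in> N (q ! i)"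
    let ?rest = "\<Union>i\<in>{i. 0 < i \<and> i < length q \<and> i \<noteq> 2 * K}. N (q ! i)"
    consider (short) "length q \<le> 2 * K"
      | (split) "2 * K < length q" "?leafy \<or> W - set q \<subseteq> ?rest"
      \<comment> \<open>Nothing off the spine hangs strictly between the head and
        \<open>q ! (2 * K)\<close>, and \<open>w\<close> depends on
        \<open>q ! (2 * K)\<close>.\<close>
      | (bare) w where "2 * K < length q" "w \<in> W - set q" "w \<notin> ?rest" "\<not> ?leafy"
    proof (cases "length q \<le> 2 * K")
      case True
      then show ?thesis by (rule that(1))
    next
      case False
      then have len: "2 * K < length q" by simp
      show ?thesis
      proof (cases "?leafy \<or> W - set q \<subseteq> ?rest")
        case True
        with len show ?thesis by (rule that(2))
      next
        case False
        note neg = False[unfolded de_Morgan_disj]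
        from neg[THEN conjunct2] obtain w where "w \<in> W - set q" "w \<notin> ?rest" 
          unfolding subset_iff by blast
        then show ?thesis using that(3)[OF len _ _ neg[THEN conjunct1]] by blast
      qed
    qed
    then show ?thesis
    proof cases
      case short
      then show ?thesis using less.prems(4) qne q k by (intro short_cover[of q W K]) auto
    next
      case split
      obtain W' r c where W': "spine r W'" "c \<in> W" "W' \<subseteq> W" "W \<subseteq> W' \<union> nball N K c"
        "card W' + (2 * K + 1) \<le> card W"
        using leaf_spine_split[OF q less.prems(2) split] .
      have "ball_cover N V {..<K} W'"
        using W' less.prems k by (intro less.IH[OF _ W'(1)])
          (auto simp: power2_eq_square intro: finite_subset)
      then have "ball_cover N V (insert K {..<K}) W"
        using W' less.prems by (intro ball_cover_insert[of N V _ W' W K c]) auto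
      then show ?thesis by (simp add: k lessThan_Suc)
    next
      case bare
      have q': "walk q" "distinct q" "set q \<subseteq> W" "W \<subseteq> set q \<union> (\<Union>u\<in>set (tl q). N u)"
        using q unfolding leaf_spine_def by auto
      have far: "\<exists>i\<ge>2 * K. 0 < i \<and> i < length q \<and> x \<in> N (q ! i)" if x: "x \<in> W - set q" for x
      proof -
        obtain u where "u \<in> set (tl q)" "x \<in> N u" using x q'(4) by blast
        then obtain i where "i < length (tl q)" "x \<in> N (tl q ! i)" by (auto simp: in_set_conv_nth)
        then have "0 < Suc i" "Suc i < length q" "x \<in> N (q ! Suc i)" by (auto simp: nth_tl)
        then show ?thesis using bare(4) x by (metis not_less)
      qed
      have w: "0 < K" "w \<in> N (q ! (2 * K))"
        using far[OF bare(2)] bare(3) by auto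
      then obtain J where K: "K = Suc J" by (cases K) auto
      \<comment> \<open>The smaller ball around \<open>q ! J\<close> removes the first
        \<open>2 * K - 1\<close> spine vertices. Then \<open>q ! (2 * K - 1)\<close> is the new head
        and \<open>q ! (2 * K)\<close> follows it, so all leaves still hang at the tail.\<close>
      define q1 where "q1 = drop (2 * J + 1) q"
      define W1 where "W1 = W - set (take (2 * J + 1) q)"
      have set_q1: "set q1 = set q - set (take (2 * J + 1) q)"
        unfolding q1_def by (rule set_drop_distinct[OF q'(2)])
      have card_W1: "card W1 + (2 * J + 1) = card W"
        using card_Diff_take[OF q'(2,3) less.prems(2), of "2 * J + 1" "{}"] bare(1) K
        by (simp add: W1_def)
      have W1: "W1 \<subseteq> W" by (auto simp: W1_def)
      have "x \<in> (\<Union>u\<in>set (tl q1). N u)" if x: "x \<in> W - set q" for x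
      proof -
        obtain i where i: "i \<ge> 2 * K" "i < length q" "x \<in> N (q ! i)"
          using far[OF x] by blast
        moreover from i(1) obtain d where "i = 2 * K + d" by (auto dest: le_Suc_ex)
        ultimately have "q ! i = tl q1 ! d" "d < length (tl q1)"
          by (auto simp: q1_def K nth_tl)
        with i show ?thesis by (metis UN_I nth_mem)
      qed
      then have q1: "leaf_spine q1 W1"
        using q'(1-3) unfolding leaf_spine_def set_q1
        by (auto simp: W1_def q1_def walk_drop)
      have J: "W \<subseteq> W1 \<union> nball N J (q ! J)"
      proof -
        have "x \<in> nball N J (q ! J)" if "x \<in> set (take (2 * J + 1) q)" for x
        proof -
          obtain i where "i < 2 * J + 1" "i < length q" "x = q ! i"
            using \<open>x \<in> _\<close> by (auto simp: in_set_conv_nth)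
          then show ?thesis using walk_nball[OF q'(1), of i J J] bare(1) K by auto
        qed
        then show ?thesis by (auto simp: W1_def)
      qed
      \<comment> \<open>Radius \<open>J\<close> is already spent, which leaves \<open>K\<close> and
        the radii below \<open>J\<close>.\<close>
      have cover1: "ball_cover N V (insert K {..<J}) W1"
      proof (cases "length q1 \<le> 2 * K")
        case True
        then show ?thesis
          using q1 W1 less.prems(4) bare(1) K by (intro short_cover[of q1 W1 K]) (auto simp: q1_def)
      next
        case False
        have "q1 ! 1 = q ! (2 * K)" using bare(1) by (simp add: q1_def K)
        moreover have "w \<in> W1 - set q1"
          using bare(2) unfolding set_q1 by (auto simp: W1_def dest: in_set_takeD)
        \<comment> \<open>\<open>w\<close> now hangs at index 1, within reach of the ball of radius
          \<open>K\<close>, so the exception cannot recur.\<close>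
        ultimately have "\<exists>w\<in>W1 - set q1. \<exists>i. 0 < i \<and> i < 2 * K \<and> w \<in> N (q1 ! i)"
          using w by (intro bexI[of _ w] exI[of _ 1]) (auto simp: K)
        then have leafy: "(\<exists>w\<in>W1 - set q1. \<exists>i. 0 < i \<and> i < 2 * K \<and> w \<in> N (q1 ! i)) \<or>
          W1 - set q1 \<subseteq> (\<Union>i\<in>{i. 0 < i \<and> i < length q1 \<and> i \<noteq> 2 * K}. N (q1 ! i))" ..
        have fin: "finite W1" and len: "2 * K < length q1"
          using False finite_subset[OF W1 less.prems(2)] by auto
        obtain W2 r c where W2: "spine r W2" "c \<in> W1" "W2 \<subseteq> W1" "W1 \<subseteq> W2 \<union> nball N K c"
          "card W2 + (2 * K + 1) \<le> card W1"
          using leaf_spine_split[OF q1 fin len leafy] .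
        have "(Suc (Suc J))\<^sup>2 = J\<^sup>2 + (2 * K + 1) + (2 * J + 1)"
          by (simp add: power2_eq_square K)
        then have "card W2 \<le> J\<^sup>2"
          using W2(5) card_W1 less.prems(3) unfolding k K by linarith
        moreover have "finite W2" "W2 \<subseteq> V"
          using W2(3) W1 less.prems(2,4) by (auto intro: finite_subset)
        ultimately have "ball_cover N V {..<J} W2"
          using k K by (intro less.IH[OF _ W2(1)]) auto
        then show ?thesis
          using W2 W1 less.prems(4) K by (intro ball_cover_insert[of N V _ W2 W1 K c]) auto
      qed
      have "q ! J \<in> set q" using bare(1) K by (intro nth_mem) simp
      then have qV: "q ! J \<in> V" using q'(3) less.prems(4) by blast
      have "ball_cover N V (insert J (insert K {..<J})) W"
        by (rule ball_cover_insert[OF cover1 J qV]) (simp add: K)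
      then show ?thesis by (simp add: k K lessThan_Suc insert_commute)
    qed
  qed
qed

end

section \<open>Dominating paths in biconvex bipartite graphs\<close>

text \<open>Orders are given by integer positions, so that reversal is negation. Connectedness takes
  the form of a closure principle, to be applied to sets defined by cells or by paths.\<close>

locale biconvex = symmetric_neighbourhood N for N :: "'a \<Rightarrow> 'a set" +
  fixes A B :: "'a set" and f g :: "'a \<Rightarrow> int"
  assumes disjoint: "A \<inter> B = {}"
    and N_A: "a \<in> A \<Longrightarrow> N a \<subseteq> B"
    and N_B: "b \<in> B \<Longrightarrow> N b \<subseteq> A"
    and convex_A: "\<lbrakk>b \<in> B; x \<in> N b; y \<in> N b; w \<in> A; f x \<le> f w; f w \<le> f y\<rbrakk> \<Longrightarrow> w \<in> N b"
    and convex_B: "\<lbrakk>a \<in> A; x \<in> N a; y \<in> N a; w \<in> B; g x \<le> g w; g w \<le> g y\<rbrakk> \<Longrightarrow> w \<in> N a"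
    and connected: "\<lbrakk>S \<inter> (A \<union> B) \<noteq> {}; \<And>v. v \<in> S \<Longrightarrow> N v \<subseteq> S\<rbrakk> \<Longrightarrow> A \<union> B \<subseteq> S"
begin

text \<open>Transposition and the reflections of the grid allow each argument to be carried out in
  one orientation only.\<close>

lemma swap_sides: "biconvex N B A g f"
proof (unfold_locales; (rule N_A N_B convex_A convex_B; assumption)?)
  show "B \<inter> A = {}" using disjoint by blast
next
  fix S assume "S \<inter> (B \<union> A) \<noteq> {}" "\<And>v. v \<in> S \<Longrightarrow> N v \<subseteq> S"
  then show "B \<union> A \<subseteq> S" using connected[of S] by blast
qed

lemma reverse_A: "biconvex N A B (\<lambda>x. - f x) g"
proof (unfold_locales; (rule disjoint N_A N_B convex_B connected; assumption)?)
  fix b x y w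
  assume "b \<in> B" "x \<in> N b" "y \<in> N b" "w \<in> A" "- f x \<le> - f w" "- f w \<le> - f y"
  then show "w \<in> N b" using convex_A[of b y x w] by simp
qed

lemma reverse_B: "biconvex N A B f (\<lambda>x. - g x)"
  using biconvex.swap_sides[OF biconvex.reverse_A[OF swap_sides]] .

text \<open>If the cell \<open>(l, t)\<close> were missing, no edge could leave the quadrant beyond it.\<close>

lemma corner:
  assumes "l \<in> A" "t \<in> B" "j \<in> N l" "g j \<le> g t" "i \<in> N t" "f i \<le> f l"
    and "q \<in> B" "r \<in> N q" "f l \<le> f r" "g t \<le> g q"
  shows "t \<in> N l"
proof (rule ccontr)
  assume no: "t \<notin> N l"
  have lt: "l \<notin> N t" using no sym by blast
  define S where "S = {a \<in> A. f l \<le> f a \<and> (\<exists>b\<in>N a. g t \<le> g b)} \<union>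
    {b \<in> B. g t \<le> g b \<and> (\<exists>a\<in>N b. f l \<le> f a)}"
  have "N v \<subseteq> S" if "v \<in> S" for v
  proof
    fix w assume w: "w \<in> N v"
    from \<open>v \<in> S\<close> consider b where "v \<in> A" "f l \<le> f v" "b \<in> N v" "g t \<le> g b"
      | a where "v \<in> B" "g t \<le> g v" "a \<in> N v" "f l \<le> f a"
      unfolding S_def by blast
    then show "w \<in> S"
    proof cases
      case 1
      \<comment> \<open>Otherwise row \<open>v\<close> has cells on both sides of column
        \<open>t\<close>, hence the cell \<open>(v, t)\<close>; with \<open>(i, t)\<close> on the
        other side of row \<open>l\<close>, column \<open>t\<close> then contains
        \<open>(l, t)\<close>. The second case is the transpose.\<close>
      have "g t \<le> g w"
      proof (rule ccontr)
        assume "\<not> g t \<le> g w"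
        then have "t \<in> N v" using convex_B[of v w b t] 1 w assms(2) by simp
        then have "v \<in> N t" by (rule sym)
        then show False using convex_A[of t i v l] 1 assms lt by blast
      qed
      then show ?thesis using 1 w N_A[of v] sym[OF w] unfolding S_def by blast
    next
      case 2
      have "f l \<le> f w"
      proof (rule ccontr)
        assume "\<not> f l \<le> f w"
        then have "l \<in> N v" using convex_A[of v w a l] 2 w assms(1) by simp
        then have "v \<in> N l" by (rule sym)
        then show False using convex_B[of l j v t] 2 assms no by blast
      qed
      then show ?thesis using 2 w N_B[of v] sym[OF w] unfolding S_def by blast
    qed
  qed
  moreover have "q \<in> S" using assms unfolding S_def by blast
  ultimately have "A \<union> B \<subseteq> S" using connected[of S] assms(7) by blast
  moreover have "j \<in> B" using assms(1,3) N_A by blast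
  \<comment> \<open>Membership forces \<open>j\<close> to the position of \<open>t\<close>, and
    convexity with \<open>j\<close> as both end-points gives the missing cell.\<close>
  ultimately have "j \<in> S" by blast
  then have "g t \<le> g j" using \<open>j \<in> B\<close> disjoint unfolding S_def by blast
  then show False using convex_B[of l j j t] assms no by simp
qed

lemma walk_constant:
  assumes "walk p" "\<And>u v. \<lbrakk>u \<in> set p; v \<in> set p; v \<in> N u\<rbrakk> \<Longrightarrow> P u = P v" "x \<in> set p"
  shows "P x = P (hd p)"
  using assms
proof (induction p)
  case (Cons a p)
  show ?case
  proof (cases "x = a")
    case False
    with Cons.prems have x: "x \<in> set p" by simp
    then have "P x = P (hd p)" using Cons.prems by (intro Cons.IH) (auto simp: successively_Cons)
    moreover have "hd p \<in> set p" using x by (cases p) auto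
    then have "P a = P (hd p)"
      using Cons.prems(1) x by (intro Cons.prems(2)) (auto simp: successively_Cons)
    ultimately show ?thesis by simp
  qed simp
qed simp

text \<open>If no column of the walk meets row \<open>z\<close>, convexity puts each of them
  entirely on one side of \<open>z\<close>, so the walk cannot change sides.\<close>

lemma walk_dominates_between:
  assumes "walk p" "set p \<subseteq> A \<union> B" "x \<in> set p" "y \<in> set p" "x \<in> A" "y \<in> A"
    and "z \<in> A" "f x < f z" "f z < f y"
  shows "\<exists>b\<in>set p. z \<in> N b"
proof (rule ccontr)
  assume no: "\<not> (\<exists>b\<in>set p. z \<in> N b)"
  define P where "P v \<longleftrightarrow> (if v \<in> A then f v < f z else \<exists>a\<in>N v. f a < f z)" for v
  have AB: "P a = P b" if "a \<in> set p" "b \<in> set p" "a \<in> A" "b \<in> N a" for a b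
  proof -
    have b: "b \<in> B" "b \<notin> A" "a \<in> N b" using that N_A disjoint sym by blast+
    have "f a < f z" if "c \<in> N b" "f c < f z" for c
      using convex_A[of b c a z] b that no \<open>b \<in> set p\<close> assms(7) by force
    then show ?thesis using b(2,3) that(3) unfolding P_def by auto
  qed
  have "P u = P v" if "u \<in> set p" "v \<in> set p" "v \<in> N u" for u v
    using AB[of u v] AB[of v u] that assms(2) sym N_B by blast
  then have "P v = P (hd p)" if "v \<in> set p" for v
    using walk_constant[OF assms(1), of P v] that by blast
  then have "P x = P y" using assms(3,4) by blast
  then show False using assms(5-9) unfolding P_def by auto
qed

text \<open>The idea is to grow paths from the edge \<open>l t\<close>, traversed in either
  direction, until \<open>r\<close> is reached, and then to attach \<open>d\<close> by the edge
  \<open>r d\<close>.\<close>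

lemma ex_path_through_distinct:
  assumes "t \<in> N l" "d \<in> N r" "l \<in> A" "r \<in> A" "l \<noteq> r" "t \<noteq> d"
  obtains p where "path p" "set p \<subseteq> A \<union> B" "{l, t, r, d} \<subseteq> set p"
proof -
  have tB: "t \<in> B" "d \<in> B" "t \<notin> A" "d \<notin> A" using assms N_A disjoint by blast+
  have lt: "l \<in> N t" "r \<in> N d" using assms sym by blast+
  define Q where "Q v x y p \<longleftrightarrow> path (x # y # p) \<and> set p \<subseteq> A \<union> B \<and> {x, y} = {l, t} \<and>
    last (x # y # p) = v \<and> p \<noteq> []" for v x y p
  \<comment> \<open>The ends of such paths form a set closed under neighbours: a path is extended by
    a new vertex or cut back to an old one.\<close>
  define S where "S = {l, t} \<union> {v. \<exists>x y p. Q v x y p}"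
  have lt': "l \<noteq> t" using assms(3) tB by blast
  have closed: "N v \<subseteq> S" if v: "v \<in> S" for v
  proof
    fix w assume w: "w \<in> N v"
    show "w \<in> S"
    proof (cases "w \<in> {l, t}")
      case wlt: False
      from v consider "v = l" | "v = t" | x y p where "Q v x y p" unfolding S_def by blast
      then show ?thesis
      proof cases
        case 1
        then have "Q w t l [w]" using w wlt lt lt' assms N_A unfolding Q_def by auto
        then show ?thesis unfolding S_def by blast
      next
        case 2
        then have "Q w l t [w]" using w wlt lt lt' assms tB N_B unfolding Q_def by auto
        then show ?thesis unfolding S_def by blast
      next
        case 3
        show ?thesis
        proof (cases "w \<in> set p")
          case True
          then obtain p1 p2 where "p = p1 @ w # p2" by (auto simp: in_set_conv_decomp)
          with 3 have "Q w x y (p1 @ [w])"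
            unfolding Q_def by (auto simp: hd_append successively_append_iff successively_Cons)
          then show ?thesis unfolding S_def by blast
        next
          case False
          have "v = last p" "p \<noteq> []" "set p \<subseteq> A \<union> B" using 3 unfolding Q_def by auto
          then have "v \<in> A \<union> B" using last_in_set by blast
          then have "w \<in> A \<union> B" using w N_A N_B by blast
          then have "Q w x y (p @ [w])"
            using 3 False w wlt unfolding Q_def
            by (auto simp: successively_append_iff successively_Cons)
          then show ?thesis unfolding S_def by blast
        qed
      qed
    qed (auto simp: S_def)
  qed
  have "A \<union> B \<subseteq> S" using connected[of S] closed assms(3) by (auto simp: S_def)
  with assms(4,5) tB have "\<exists>x y p. Q r x y p" unfolding S_def by auto
  then obtain x y p where p: "Q r x y p" by blast
  show thesis
  proof (cases "d \<in> set p")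
    case False
    then have "d \<notin> set (x # y # p)" using p assms tB unfolding Q_def by auto
    then have "path (x # y # p @ [d])"
      using p assms(2) unfolding Q_def by (auto simp: successively_append_iff successively_Cons)
    moreover have "set (x # y # p @ [d]) \<subseteq> A \<union> B"
      using p assms(3) tB unfolding Q_def by auto
    moreover have "{l, t, r, d} \<subseteq> set (x # y # p @ [d])"
      using p last_in_set[of p] unfolding Q_def by auto
    ultimately show thesis by (rule that)
  next
    case True
    then obtain p1 p2 where p12: "p = p1 @ d # p2" by (auto simp: in_set_conv_decomp)
    \<comment> \<open>The path meets \<open>d\<close> before its end \<open>r\<close>; what follows
      \<open>d\<close> is replaced by the single step to \<open>r\<close>.\<close>
    have "p2 \<noteq> []" using p p12 assms(4) tB unfolding Q_def by auto
    then have "r \<in> set p2" using p p12 last_in_set[of p2] unfolding Q_def by auto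
    then have "path (x # y # p1 @ [d, r])"
      using p p12 lt unfolding Q_def by (auto simp: hd_append successively_append_iff successively_Cons)
    moreover have "set (x # y # p1 @ [d, r]) \<subseteq> A \<union> B"
      using p p12 assms(3,4) tB unfolding Q_def by auto
    moreover have "{l, t, r, d} \<subseteq> set (x # y # p1 @ [d, r])"
      using p unfolding Q_def by auto
    ultimately show thesis by (rule that)
  qed
qed

lemma ex_path_through:
  assumes "t \<in> N l" "d \<in> N r" "l \<in> A" "r \<in> A"
  obtains p where "path p" "set p \<subseteq> A \<union> B" "{l, t, r, d} \<subseteq> set p"
proof -
  have B: "t \<in> B" "d \<in> B" "t \<notin> A" "d \<notin> A" using assms N_A disjoint by blast+
  have sym': "l \<in> N t" "r \<in> N d" using assms sym by blast+
  consider "l = r" "t = d" | "l = r" "t \<noteq> d" | "l \<noteq> r" "t = d" | "l \<noteq> r" "t \<noteq> d" by blast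
  then show thesis
  proof cases
    case 1
    show ?thesis by (rule that[of "[l, t]"]) (use 1 assms B in auto)
  next
    case 2
    show ?thesis by (rule that[of "[t, l, d]"]) (use 2 assms B sym' in auto)
  next
    case 3
    show ?thesis by (rule that[of "[l, t, r]"]) (use 3 assms B sym' in auto)
  next
    case 4
    show ?thesis using ex_path_through_distinct[OF assms 4] that by blast
  qed
qed

text \<open>
  Here \<open>l\<close> and \<open>r\<close> are rows that meet the leftmost and the rightmost column \<open>jl\<close> and \<open>jr\<close>, while
  \<open>t\<close> and \<open>d\<close> are columns that meet the top and the bottom row \<open>it\<close> and \<open>ib\<close>. If the two diagonals
  run in opposite directions, the four vertices form a dominating 4-cycle; otherwise every path
  through all four is dominating.
\<close>

lemma ex_spine_oriented:
  assumes "jl \<in> B" "jr \<in> B" "\<And>b. b \<in> B \<Longrightarrow> g jl \<le> g b \<and> g b \<le> g jr"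
    and "it \<in> A" "ib \<in> A" "\<And>a. a \<in> A \<Longrightarrow> f it \<le> f a \<and> f a \<le> f ib"
    and "l \<in> N jl" "r \<in> N jr" "t \<in> N it" "d \<in> N ib" "f l \<le> f r"
  shows "\<exists>p. spine p (A \<union> B)"
proof -
  have mem: "l \<in> A" "r \<in> A" "t \<in> B" "d \<in> B"
    using assms N_A N_B by blast+
  have nb: "jl \<in> N l" "jr \<in> N r" "it \<in> N t" "ib \<in> N d"
    using assms sym by blast+
  note ext = assms(1-6) mem nb assms(7-11)
  have tl: "t \<in> N l"
    using corner[of l t jl it jr r] ext by blast
  interpret rev: biconvex N A B "\<lambda>x. - f x" "\<lambda>x. - g x"
    using biconvex.reverse_B[OF reverse_A] .
  interpret revA: biconvex N A B "\<lambda>x. - f x" g by (rule reverse_A)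
  interpret revB: biconvex N A B f "\<lambda>x. - g x" by (rule reverse_B)
  interpret sw: biconvex N B A g f by (rule swap_sides)
  \<comment> \<open>The same corner argument after a half-turn of the grid.\<close>
  have dr: "d \<in> N r"
    using rev.corner[of r d jr ib jl l] ext by simp
  have sp: "\<exists>p. spine p (A \<union> B)"
    if p: "path p" "set p \<subseteq> A \<union> B" and dom: "\<And>v. v \<in> A \<union> B \<Longrightarrow> v \<in> (\<Union>u\<in>set p. N u)" for p
    using that unfolding spine_def by blast
  have lt: "l \<in> N t" "r \<in> N d" using tl dr sym by blast+
  show ?thesis
  proof (cases "g t \<le> g d")
    case True
    obtain p where p: "path p" "set p \<subseteq> A \<union> B" "{l, t, r, d} \<subseteq> set p"
      using ex_path_through[OF tl dr mem(1,2)] .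
    show ?thesis
    proof (rule sp[OF p(1,2)])
      fix v assume "v \<in> A \<union> B"
      \<comment> \<open>Column \<open>t\<close> contains the rows from \<open>it\<close> to
        \<open>l\<close> and column \<open>d\<close> those from \<open>r\<close> to
        \<open>ib\<close>; the path must cross the rows in between. The same holds for
        columns.\<close>
      then consider "v \<in> A" "f v \<le> f l" | "v \<in> A" "f r \<le> f v" | "v \<in> A" "f l < f v" "f v < f r"
        | "v \<in> B" "g v \<le> g t" | "v \<in> B" "g d \<le> g v" | "v \<in> B" "g t < g v" "g v < g d"
        by fastforce
      then show "v \<in> (\<Union>u\<in>set p. N u)"
      proof cases
        case 1
        then have "v \<in> N t" using convex_A[of t it l v] ext lt by blast
        then show ?thesis using p(3) by blast
      next
        case 2
        then have "v \<in> N d" using convex_A[of d r ib v] ext lt by blast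
        then show ?thesis using p(3) by blast
      next
        case 3
        then show ?thesis
          using walk_dominates_between[of p l r v] p mem by blast
      next
        case 4
        then have "v \<in> N l" using convex_B[of l jl t v] ext tl by blast
        then show ?thesis using p(3) by blast
      next
        case 5
        then have "v \<in> N r" using convex_B[of r d jr v] ext dr by blast
        then show ?thesis using p(3) by blast
      next
        case 6
        then show ?thesis
          using sw.walk_dominates_between[of p t d v] p mem by blast
      qed
    qed
  next
    case False
    \<comment> \<open>With \<open>d\<close> before \<open>t\<close>, the two reflections supply the
      other corners. Column \<open>t\<close> now reaches down to \<open>r\<close> and column
      \<open>d\<close> up to \<open>l\<close>, so together they meet every row.\<close>
    have dl: "d \<in> N l"
      using revA.corner[of l d jl ib t it] ext False by simp
    have tr: "t \<in> N r"
      using revB.corner[of r t jr it d ib] ext False by simp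
    have "l \<in> N d" "r \<in> N t" using dl tr sym by blast+
    obtain p where p: "path p" "set p \<subseteq> A \<union> B" "{l, t, r, d} \<subseteq> set p"
      using ex_path_through[OF tl dr mem(1,2)] .
    show ?thesis
    proof (rule sp[OF p(1,2)])
      fix v assume "v \<in> A \<union> B"
      then consider "v \<in> A" "f v \<le> f r" | "v \<in> A" "f l \<le> f v" | "v \<in> B" "g v \<le> g t" | "v \<in> B" "g d \<le> g v"
        using assms(11) False by fastforce
      then show "v \<in> (\<Union>u\<in>set p. N u)"
      proof cases
        case 1
        then have "v \<in> N t" using convex_A[of t it r v] ext \<open>r \<in> N t\<close> by blast
        then show ?thesis using p(3) by blast
      next
        case 2
        then have "v \<in> N d" using convex_A[of d l ib v] ext \<open>l \<in> N d\<close> by blast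
        then show ?thesis using p(3) by blast
      next
        case 3
        then have "v \<in> N l" using convex_B[of l jl t v] ext tl by blast
        then show ?thesis using p(3) by blast
      next
        case 4
        then have "v \<in> N r" using convex_B[of r d jr v] ext dr by blast
        then show ?thesis using p(3) by blast
      qed
    qed
  qed
qed

lemma ex_spine:
  assumes "finite A" "finite B" "A \<union> B \<noteq> {}"
  shows "\<exists>p. spine p (A \<union> B)"
\<comment> \<open>A vertex without neighbours is the whole graph. Otherwise both sides are nonempty
  and extremal rows and columns exist.\<close>
proof (cases "\<exists>v\<in>A \<union> B. N v = {}")
  case True
  then obtain v where v: "v \<in> A \<union> B" "N v = {}" by blast
  then have "A \<union> B \<subseteq> {v}" using connected[of "{v}"] by auto
  with v have "spine [v] (A \<union> B)" unfolding spine_def by auto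
  then show ?thesis ..
next
  case False
  then have nonempty: "\<And>v. v \<in> A \<union> B \<Longrightarrow> N v \<noteq> {}" by simp
  then have ne: "A \<noteq> {}" "B \<noteq> {}" using assms(3) N_A N_B by blast+
  have minmax: "\<exists>x\<in>X. \<exists>y\<in>X. \<forall>z\<in>X. h x \<le> h z \<and> h z \<le> h y"
    if "finite X" "X \<noteq> {}" for X and h :: "'a \<Rightarrow> int"
  proof -
    have "finite (h ` X)" "h ` X \<noteq> {}" using that by auto
    then have "Min (h ` X) \<in> h ` X" "Max (h ` X) \<in> h ` X"
      by (rule Min_in, rule Max_in)
    then obtain x y where "x \<in> X" "Min (h ` X) = h x" "y \<in> X" "Max (h ` X) = h y"
      by blast
    moreover have "Min (h ` X) \<le> h z" "h z \<le> Max (h ` X)" if "z \<in> X" for z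
      using that \<open>finite X\<close> by auto
    ultimately show ?thesis by metis
  qed
  obtain jl jr where j: "jl \<in> B" "jr \<in> B" "\<And>b. b \<in> B \<Longrightarrow> g jl \<le> g b \<and> g b \<le> g jr"
    using minmax[OF assms(2) ne(2), of g] by blast
  obtain it ib where i: "it \<in> A" "ib \<in> A" "\<And>a. a \<in> A \<Longrightarrow> f it \<le> f a \<and> f a \<le> f ib"
    using minmax[OF assms(1) ne(1), of f] by blast
  have "N jl \<noteq> {}" "N jr \<noteq> {}" "N it \<noteq> {}" "N ib \<noteq> {}"
    using nonempty i(1,2) j(1,2) by simp_all
  then obtain l r t d where e: "l \<in> N jl" "r \<in> N jr" "t \<in> N it" "d \<in> N ib"
    by blast
  show ?thesis
  proof (cases "f l \<le> f r")
    case True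
    show ?thesis by (rule ex_spine_oriented[OF j i e True])
  next
    case False
    interpret revA: biconvex N A B "\<lambda>x. - f x" g by (rule reverse_A)
    show ?thesis
      \<comment> \<open>Reversing the rows exchanges \<open>it\<close> with \<open>ib\<close> and
        \<open>t\<close> with \<open>d\<close>.\<close>
      by (rule revA.ex_spine_oriented[OF j i(2,1) _ e(1,2,4,3)]) (use i(3) False in auto)
  qed
qed

end

section \<open>The burning number\<close>

text \<open>The position of \<open>x\<close> is the number of its predecessors; by transitivity a
  strictly later element has strictly more.\<close>

lemma linear_order_rank:
  assumes "linear_order_on A r" "finite A"
  obtains f :: "'a \<Rightarrow> int" where "\<And>x y. \<lbrakk>x \<in> A; y \<in> A; f x \<le> f y\<rbrakk> \<Longrightarrow> (x, y) \<in> r"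
proof
  fix x y assume xy: "x \<in> A" "y \<in> A" "int (card {z \<in> A. (z, x) \<in> r}) \<le> int (card {z \<in> A. (z, y) \<in> r})"
  have r: "refl_on A r" "trans r" "total_on A r"
    using assms(1) unfolding linear_order_on_def partial_order_on_def preorder_on_def by auto
  show "(x, y) \<in> r"
  proof (rule ccontr)
    assume no: "(x, y) \<notin> r"
    have xx: "(x, x) \<in> r" using r(1) xy(1) by (auto dest: refl_onD)
    with no have "x \<noteq> y" by blast
    then have "(y, x) \<in> r" using no r(3) xy unfolding total_on_def by blast
    then have "{z \<in> A. (z, y) \<in> r} \<subset> {z \<in> A. (z, x) \<in> r}"
      using no xx xy r(2) by (auto dest: transD)
    then have "card {z \<in> A. (z, y) \<in> r} < card {z \<in> A. (z, x) \<in> r}"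
      using assms(2) by (intro psubset_card_mono) auto
    then show False using xy(3) by simp
  qed
qed

section \<open>From ball covers to burning sequences\<close>

lemma nball_subset_burned:
  "s t = Some v \<Longrightarrow> nball (neighbours G) r v \<subseteq> burned G s (Suc t + r)"
  by (induction r) auto

lemma (in wf_digraph) ball_cover_burnable:
  assumes "ball_cover (neighbours G) (verts G) {..<k} (verts G)"
  shows "burnable_in G k"
proof -
  obtain c where c: "\<forall>r\<in>{..<k}. c r \<in> verts G"
    "verts G \<subseteq> (\<Union>r\<in>{..<k}. nball (neighbours G) r (c r))"
    using assms unfolding ball_cover_def by blast
  \<comment> \<open>A vertex chosen at index \<open>t\<close> burns in iteration
    \<open>t + 1\<close> and has \<open>k - 1 - t\<close> iterations left to spread, so larger balls
    are lit first.\<close>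
  define s where "s t = (if t < k then Some (c (k - 1 - t)) else None)" for t
  have s: "set_option (s t) \<subseteq> verts G" for t
    using c(1) by (auto simp: s_def)
  have "burned G s j \<subseteq> verts G" for j
    using s by (induction j) (auto simp: neighbours_def dest: adj_in_verts)
  moreover have "nball (neighbours G) r (c r) \<subseteq> burned G s k" if "r < k" for r
    using nball_subset_burned[of s "k - 1 - r" "c r" G r] that by (simp add: s_def)
  ultimately have "burned G s k = verts G" using c(2) by blast
  with s show ?thesis unfolding burnable_in_def by blast
qed

lemma (in graph) connected_closed:
  assumes "Digraph_Component.connected G" "S \<inter> verts G \<noteq> {}"
    and "\<And>v. v \<in> S \<Longrightarrow> neighbours G v \<subseteq> S"
  shows "verts G \<subseteq> S"
proof
  fix v assume v: "v \<in> verts G"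
  obtain u where u: "u \<in> S" "u \<in> verts G" using assms(2) by blast
  have "strongly_connected G"
    \<comment> \<open>Symmetry of the arcs turns connectedness into directed reachability, along
      which \<open>S\<close> is preserved.\<close>
    using assms(1) symmetric_connected_imp_strongly_connected sym_arcs by blast
  then have "u \<rightarrow>\<^sup>*\<^bsub>G\<^esub> v" using u v by blast
  then show "v \<in> S"
    by (induction rule: reachable_induct) (use u assms(3) in \<open>auto simp: neighbours_def\<close>)
qed

theorem corollary3p3:
  fixes G :: "('a, 'b) pre_digraph" and n :: nat
  assumes "graph G"
    and "Digraph_Component.connected G"
    and "biconvex_bipartite G"
    and "card (verts G) = n"
  shows "int (burning_number G) \<le> \<lceil>sqrt (real n)\<rceil>"
proof -
  interpret graph G by fact
  obtain A B rA rB where AB: "bipartition G A B"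
    and lin: "linear_order_on A rA" "linear_order_on B rB"
    and cons: "\<And>a. a \<in> A \<Longrightarrow> consecutive rB (neighbours G a)"
      "\<And>b. b \<in> B \<Longrightarrow> consecutive rA (neighbours G b)"
    using assms(3) unfolding biconvex_bipartite_def by blast
  have V: "A \<union> B = verts G" and disj: "A \<inter> B = {}"
    using AB unfolding bipartition_def by auto
  have fin: "finite A" "finite B" using V finite_verts by (metis finite_Un)+
  obtain f :: "'a \<Rightarrow> int" where f: "\<And>x y. \<lbrakk>x \<in> A; y \<in> A; f x \<le> f y\<rbrakk> \<Longrightarrow> (x, y) \<in> rA"
    using linear_order_rank[OF lin(1) fin(1)] by blast
  obtain g :: "'a \<Rightarrow> int" where g: "\<And>x y. \<lbrakk>x \<in> B; y \<in> B; g x \<le> g y\<rbrakk> \<Longrightarrow> (x, y) \<in> rB"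
    using linear_order_rank[OF lin(2) fin(2)] by blast
  have nA: "neighbours G a \<subseteq> B" if "a \<in> A" for a
    using AB disj that unfolding bipartition_def neighbours_def by blast
  have nB: "neighbours G b \<subseteq> A" if "b \<in> B" for b
    using AB disj that unfolding bipartition_def neighbours_def by blast
  interpret bc: biconvex "neighbours G" A B f g
  proof (unfold_locales; (rule disj nA nB; assumption)?)
    show "u \<in> neighbours G v" if "v \<in> neighbours G u" for u v
      using that unfolding neighbours_def by (simp add: graph_symmetric)
    show "w \<in> neighbours G b"
      if "b \<in> B" "x \<in> neighbours G b" "y \<in> neighbours G b" "w \<in> A" "f x \<le> f w" "f w \<le> f y" for b x y w
      using cons(2)[OF that(1)] f nB[OF that(1)] that(2-6) unfolding consecutive_def by blast
    show "w \<in> neighbours G a"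
      if "a \<in> A" "x \<in> neighbours G a" "y \<in> neighbours G a" "w \<in> B" "g x \<le> g w" "g w \<le> g y" for a x y w
      using cons(1)[OF that(1)] g nA[OF that(1)] that(2-6) unfolding consecutive_def by blast
    show "A \<union> B \<subseteq> S" if "S \<inter> (A \<union> B) \<noteq> {}" "\<And>v. v \<in> S \<Longrightarrow> neighbours G v \<subseteq> S" for S
      using connected_closed[OF assms(2)] that unfolding V by blast
  qed
  have ne: "verts G \<noteq> {}"
    using assms(2) unfolding connected_def strongly_connected_def by simp
  obtain p where p: "bc.spine p (verts G)"
    using bc.ex_spine[OF fin] ne unfolding V by blast
  define k where "k = nat \<lceil>sqrt (real n)\<rceil>"
  have "sqrt (real n) \<le> real k" unfolding k_def by linarith
  then have "(sqrt (real n))\<^sup>2 \<le> (real k)\<^sup>2" by (intro power_mono) auto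
  then have "real n \<le> real (k\<^sup>2)" by simp
  then have "card (verts G) \<le> k\<^sup>2" unfolding assms(4) of_nat_le_iff .
  then have "ball_cover (neighbours G) (verts G) {..<k} (verts G)"
    by (intro bc.spine_ball_cover[OF p]) (use ne in auto)
  then have "burnable_in G k" by (rule ball_cover_burnable)
  then have "burning_number G \<le> k" unfolding burning_number_def by (rule Least_le)
  \<comment> \<open>Nonnegativity ensures that \<open>nat\<close> in the definition of
    \<open>k\<close> does not change the value.\<close>
  moreover have "0 \<le> \<lceil>sqrt (real n)\<rceil>" using ceiling_mono[of 0 "sqrt (real n)"] by simp
  ultimately show ?thesis unfolding k_def by linarith
qed

end
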